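(* Let $H=L_2(\omega)$ be the finite-dimensional real Hilbert space of grid functions on a uniform rectangular grid $\omega$, with inner product $(\cdot,\cdot)$ and norm $\|\cdot\|$, let $E$ be the identity operator on $H$, and let $\delta>0$. Let $T>0$, let $N\ge 1$ be an integer, and put $\tau=T/N$, $t^n=n\tau$. For $n=0,1,\dots,N-1$ let $A^n:H\to H$ be a linear (not necessarily self-adjoint) operator, namely the value of the discrete convection-diffusion operator $A=A(t)$ used on the step from $t^n$ to $t^{n+1}$, satisfying $A^n\ge-\delta E$, i.e. $(A^n y,y)\ge-\delta\|y\|^2$ for all $y\in H$. Let $\sigma\ge 0.5$ be a real number, and let $y^0=u^0\in H$ be given. Consider the difference scheme $$\frac{\exp(-\delta\tau)\,y^{n+1}-y^n}{\tau}+\left(A^n+\delta E\right)\left(\sigma\exp(-\delta\tau)\,y^{n+1}+(1-\sigma)\,y^n\right)=0,\qquad n=0,1,\dots,N-1.$$ Then this scheme is unconditionally $\varrho$-stable in $H$ with $\varrho=\exp(\delta\tau)$: with no restriction on the time step $\tau>0$, its solutions satisfy $$\|y^{n+1}\|\le\varrho\,\|y^n\|,\qquad \varrho=\exp(\delta\tau),\qquad n=0,1,\dots,N-1.$$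
   Context: The grid is $\omega=\{(x_1,x_2): x_\alpha=(i_\alpha+\tfrac12)h_\alpha,\ i_\alpha=0,\dots,N_\alpha,\ (N_\alpha+1)h_\alpha=l_\alpha,\ \alpha=1,2\}$ in the rectangle $\Omega=(0,l_1)\times(0,l_2)$. The space $H=L_2(\omega)$ consists of real functions on $\omega$ with $(y,w)=\sum_{\bm x\in\omega}y(\bm x)w(\bm x)h_1h_2$ and $\|y\|=(y,y)^{1/2}$. The scheme approximates the Cauchy problem $\frac{dy}{dt}+Ay=0$, $0<t\le T$, $y(0)=u^0$. Here $A=A(t)=C(t)+D$, where $D$ is a discrete diffusion operator (with Neumann boundary conditions) satisfying $D=D^*\ge0$, and $C(t)$ is a discrete convection operator satisfying $|(C y,y)|\le\delta\|y\|^2$ for all $y\in H$; hence $A\ge-\delta E$. A scheme is called $\varrho$-stable in $H$ if its solutions (with homogeneous right-hand side) satisfy $\|y^{n+1}\|\le\varrho\|y^n\|$ at every time step, and unconditionally $\varrho$-stable if this holds for every time step $\tau>0$. *)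

theory Defs
  imports Complex_Main "HOL-Library.FuncSet"
begin

definition grid :: "real \<Rightarrow> real \<Rightarrow> nat \<Rightarrow> nat \<Rightarrow> (real \<times> real) set" where
  "grid h1 h2 N1 N2 =
     {((real i + 1/2) * h1, (real j + 1/2) * h2) | i j. i \<le> N1 \<and> j \<le> N2}"

type_synonym grid_fun = "real \<times> real \<Rightarrow> real"

(* A real function on the grid \<omega> is represented by its extension by zero to all of the plane,
   so that distinct elements of the space are distinct functions on \<omega> and
   pointwise addition and scaling stay inside the space. *)
definition grid_space :: "(real \<times> real) set \<Rightarrow> grid_fun set" where
  "grid_space \<omega> = {y. \<forall>x. x \<notin> \<omega> \<longrightarrow> y x = 0}"

definition grid_inner :: "(real \<times> real) set \<Rightarrow> real \<Rightarrow> real \<Rightarrow> grid_fun \<Rightarrow> grid_fun \<Rightarrow> real" where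
  "grid_inner \<omega> h1 h2 y w = (\<Sum>x\<in>\<omega>. y x * w x * h1 * h2)"

definition grid_norm :: "(real \<times> real) set \<Rightarrow> real \<Rightarrow> real \<Rightarrow> grid_fun \<Rightarrow> real" where
  "grid_norm \<omega> h1 h2 y = sqrt (grid_inner \<omega> h1 h2 y y)"

definition linear_operator :: "(real \<times> real) set \<Rightarrow> (grid_fun \<Rightarrow> grid_fun) \<Rightarrow> bool" where
  "linear_operator \<omega> A \<longleftrightarrow>
     A \<in> grid_space \<omega> \<rightarrow> grid_space \<omega> \<and>
     (\<forall>y\<in>grid_space \<omega>. \<forall>z\<in>grid_space \<omega>. A (\<lambda>x. y x + z x) = (\<lambda>x. A y x + A z x)) \<and>
     (\<forall>c. \<forall>y\<in>grid_space \<omega>. A (\<lambda>x. c * y x) = (\<lambda>x. c * A y x))"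

(* A two-level scheme is given by a relation S such that S n y z expresses that the
   equation for the step from level n to level n + 1 holds with y at level n
   and z at level n + 1. *)
type_synonym two_level_scheme = "nat \<Rightarrow> grid_fun \<Rightarrow> grid_fun \<Rightarrow> bool"

definition scheme_solution ::
  "(real \<times> real) set \<Rightarrow> nat \<Rightarrow> two_level_scheme \<Rightarrow> grid_fun \<Rightarrow> (nat \<Rightarrow> grid_fun) \<Rightarrow> bool" where
  "scheme_solution \<omega> N S u0 y \<longleftrightarrow>
     y 0 = u0 \<and> (\<forall>n\<le>N. y n \<in> grid_space \<omega>) \<and> (\<forall>n<N. S n (y n) (y (Suc n)))"

definition rho_stable ::
  "(real \<times> real) set \<Rightarrow> real \<Rightarrow> real \<Rightarrow> nat \<Rightarrow> two_level_scheme \<Rightarrow> real \<Rightarrow> bool" where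
  "rho_stable \<omega> h1 h2 N S \<rho> \<longleftrightarrow>
     (\<forall>u0\<in>grid_space \<omega>. \<forall>y. scheme_solution \<omega> N S u0 y \<longrightarrow>
        (\<forall>n<N. grid_norm \<omega> h1 h2 (y (Suc n)) \<le> \<rho> * grid_norm \<omega> h1 h2 (y n)))"

(* S \<tau> is the scheme with time step \<tau>, and \<rho> may depend on \<tau>.
   On [0, T] the time steps are the numbers \<tau> = T / N with N \<ge> 1;
   none of them is excluded. *)
definition unconditionally_rho_stable ::
  "(real \<times> real) set \<Rightarrow> real \<Rightarrow> real \<Rightarrow> real \<Rightarrow> (real \<Rightarrow> two_level_scheme) \<Rightarrow> (real \<Rightarrow> real) \<Rightarrow> bool"
  where
  "unconditionally_rho_stable \<omega> h1 h2 T S \<rho> \<longleftrightarrow>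
     (\<forall>\<tau>>0. \<forall>N\<ge>1. \<tau> = T / real N \<longrightarrow> rho_stable \<omega> h1 h2 N (S \<tau>) (\<rho> \<tau>))"

definition weighted_exp_scheme ::
  "(real \<times> real) set \<Rightarrow> real \<Rightarrow> real \<Rightarrow> real \<Rightarrow> (nat \<Rightarrow> grid_fun \<Rightarrow> grid_fun) \<Rightarrow> two_level_scheme"
  where
  "weighted_exp_scheme \<omega> \<delta> \<sigma> \<tau> A n y z \<longleftrightarrow>
     (let v = (\<lambda>x. \<sigma> * exp (- \<delta> * \<tau>) * z x + (1 - \<sigma>) * y x)
      in \<forall>x\<in>\<omega>. (exp (- \<delta> * \<tau>) * z x - y x) / \<tau> + (A n v x + \<delta> * v x) = 0)"

end

theory Submission
  imports Defs
begin

text \<open>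
  Put \<open>w = exp (- \<delta> \<tau>) y\<^sup>n\<^sup>+\<^sup>1\<close> and \<open>v = \<sigma> w + (1 - \<sigma>) y\<^sup>n\<close>. Taking the inner product of the
  scheme with \<open>v\<close> and using \<open>A\<^sup>n + \<delta> E \<ge> 0\<close> gives \<open>(w - y\<^sup>n, v) \<le> 0\<close>. Since
  \<open>2 (w - y\<^sup>n, v) = \<parallel>w\<parallel>\<^sup>2 - \<parallel>y\<^sup>n\<parallel>\<^sup>2 + (2 \<sigma> - 1) \<parallel>w - y\<^sup>n\<parallel>\<^sup>2\<close> and \<open>\<sigma> \<ge> 1/2\<close>, this yields
  \<open>\<parallel>w\<parallel> \<le> \<parallel>y\<^sup>n\<parallel>\<close>.
\<close>

lemma grid_inner_self_nonneg: "h1 * h2 \<ge> 0 \<Longrightarrow> grid_inner \<omega> h1 h2 y y \<ge> 0"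
  unfolding grid_inner_def by (intro sum_nonneg) (simp add: mult.assoc flip: power2_eq_square)

lemma grid_norm_power2: "h1 * h2 \<ge> 0 \<Longrightarrow> (grid_norm \<omega> h1 h2 y)\<^sup>2 = grid_inner \<omega> h1 h2 y y"
  by (simp add: grid_norm_def grid_inner_self_nonneg)

lemma grid_norm_scale: "grid_norm \<omega> h1 h2 (\<lambda>x. c * y x) = \<bar>c\<bar> * grid_norm \<omega> h1 h2 y"
proof -
  have "grid_inner \<omega> h1 h2 (\<lambda>x. c * y x) (\<lambda>x. c * y x) = c\<^sup>2 * grid_inner \<omega> h1 h2 y y"
    unfolding grid_inner_def sum_distrib_left
    by (intro sum.cong refl) (simp add: power2_eq_square mult_ac)
  then show ?thesis
    by (simp add: grid_norm_def real_sqrt_mult)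
qed

text \<open>The operator enters only through the grid function \<open>B\<close>, which stands for
  its value at \<open>v\<close>. The energy balance already holds at each grid point, so the sign of
  the inner product of \<open>B\<close> and \<open>v\<close> is needed only after summation.\<close>

lemma weighted_step_norm_le:
  fixes v w y B :: grid_fun
  assumes h: "h1 * h2 \<ge> 0" and \<tau>: "\<tau> > 0" and \<sigma>: "\<sigma> \<ge> 1/2"
    and v: "\<And>x. x \<in> \<omega> \<Longrightarrow> v x = \<sigma> * w x + (1 - \<sigma>) * y x"
    and step: "\<And>x. x \<in> \<omega> \<Longrightarrow> (w x - y x) / \<tau> + B x = 0"
    and B: "grid_inner \<omega> h1 h2 B v \<ge> 0"
  shows "grid_norm \<omega> h1 h2 w \<le> grid_norm \<omega> h1 h2 y"
proof -
  have pointwise: "w x * w x * h1 * h2 \<le> y x * y x * h1 * h2 - 2 * \<tau> * (B x * v x * h1 * h2)"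
    if "x \<in> \<omega>" for x
  proof -
    have "w x - y x = - \<tau> * B x"
      using step[OF that] \<tau> by (simp add: field_simps)
    \<comment> \<open>This rests on the splitting
      \<open>v = (w + y) / 2 + (\<sigma> - 1/2) * (w - y)\<close> at \<open>x\<close>: the mean
      yields the difference of squares, the rest the square term.\<close>
    moreover have "w x * w x - y x * y x + (2 * \<sigma> - 1) * (w x - y x)\<^sup>2 = 2 * ((w x - y x) * v x)"
      unfolding v[OF that] by (simp add: power2_eq_square algebra_simps)
    moreover have "(2 * \<sigma> - 1) * (w x - y x)\<^sup>2 \<ge> 0"
      using \<sigma> by simp
    ultimately have "w x * w x \<le> y x * y x - 2 * \<tau> * (B x * v x)"
      by (simp add: mult_ac)
    from mult_right_mono[OF this h] show ?thesis
      by (simp add: algebra_simps)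
  qed
  have "grid_inner \<omega> h1 h2 w w
      \<le> (\<Sum>x\<in>\<omega>. y x * y x * h1 * h2 - 2 * \<tau> * (B x * v x * h1 * h2))"
    unfolding grid_inner_def using pointwise by (rule sum_mono)
  also have "\<dots> = grid_inner \<omega> h1 h2 y y - 2 * \<tau> * grid_inner \<omega> h1 h2 B v"
    by (simp add: grid_inner_def sum_subtractf sum_distrib_left)
  also have "\<dots> \<le> grid_inner \<omega> h1 h2 y y"
    using \<tau> B by simp
  finally show ?thesis
    by (simp add: grid_norm_def)
qed

theorem theorem1:
  fixes l1 l2 h1 h2 T \<delta> \<sigma> :: real
    and N1 N2 :: nat
    and \<omega> :: "(real \<times> real) set"
    and A :: "real \<Rightarrow> nat \<Rightarrow> grid_fun \<Rightarrow> grid_fun"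
  assumes "l1 > 0" and "l2 > 0"
    and "(real N1 + 1) * h1 = l1" and "(real N2 + 1) * h2 = l2"
    and "\<omega> = grid h1 h2 N1 N2"
    and "\<delta> > 0" and "T > 0" and "\<sigma> \<ge> 1/2"
    and "\<And>N n. N \<ge> 1 \<Longrightarrow> n < N \<Longrightarrow> linear_operator \<omega> (A (T / real N) n)"
    and "\<And>N n y. N \<ge> 1 \<Longrightarrow> n < N \<Longrightarrow> y \<in> grid_space \<omega> \<Longrightarrow>
           grid_inner \<omega> h1 h2 (A (T / real N) n y) y \<ge> - \<delta> * (grid_norm \<omega> h1 h2 y)\<^sup>2"
  shows "unconditionally_rho_stable \<omega> h1 h2 T
           (\<lambda>\<tau>. weighted_exp_scheme \<omega> \<delta> \<sigma> \<tau> (A \<tau>)) (\<lambda>\<tau>. exp (\<delta> * \<tau>))"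
proof -
  have "h1 > 0" "h2 > 0"
    using assms(1-4) by (auto simp: zero_less_mult_iff)
  then have h: "h1 * h2 \<ge> 0"
    by simp
  have "grid_norm \<omega> h1 h2 (y (Suc n)) \<le> exp (\<delta> * \<tau>) * grid_norm \<omega> h1 h2 (y n)"
    if \<tau>: "\<tau> > 0" "\<tau> = T / real N" and N: "N \<ge> 1" and n: "n < N"
      and sol: "scheme_solution \<omega> N (weighted_exp_scheme \<omega> \<delta> \<sigma> \<tau> (A \<tau>)) u0 y"
    for \<tau> N u0 y n
  proof -
    define w where "w = (\<lambda>x. exp (- \<delta> * \<tau>) * y (Suc n) x)"
    define v where "v = (\<lambda>x. \<sigma> * w x + (1 - \<sigma>) * y n x)"
    have "y n \<in> grid_space \<omega>" "y (Suc n) \<in> grid_space \<omega>"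
      and "weighted_exp_scheme \<omega> \<delta> \<sigma> \<tau> (A \<tau>) n (y n) (y (Suc n))"
      using sol n by (auto simp: scheme_solution_def)
    \<comment> \<open>The lower bound on \<open>A\<close> is available only on
      \<open>grid_space \<omega>\<close>, so \<open>v\<close> must vanish off the grid.\<close>
    then have vH: "v \<in> grid_space \<omega>"
      and step: "\<forall>x\<in>\<omega>. (w x - y n x) / \<tau> + (A \<tau> n v x + \<delta> * v x) = 0"
      by (auto simp: v_def w_def grid_space_def weighted_exp_scheme_def Let_def mult.assoc)
    have "grid_inner \<omega> h1 h2 (\<lambda>x. A \<tau> n v x + \<delta> * v x) v
        = grid_inner \<omega> h1 h2 (A \<tau> n v) v + \<delta> * grid_inner \<omega> h1 h2 v v"
      by (simp add: grid_inner_def sum.distrib sum_distrib_left algebra_simps)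
    \<comment> \<open>The shift by \<open>\<delta>\<close> exactly offsets the lower bound of
      \<open>A \<tau> n\<close>.\<close>
    also have "\<dots> \<ge> 0"
      using assms(10)[OF N n vH] by (simp add: \<tau>(2) grid_norm_power2[OF h])
    finally have "grid_norm \<omega> h1 h2 w \<le> grid_norm \<omega> h1 h2 (y n)"
      using h \<tau>(1) assms(8) step by (intro weighted_step_norm_le[where v = v]) (auto simp: v_def)
    \<comment> \<open>The positive factor in \<open>w\<close> comes out of the norm; its inverse is
      the growth factor \<open>exp (\<delta> * \<tau>)\<close>.\<close>
    then have "exp (- \<delta> * \<tau>) * grid_norm \<omega> h1 h2 (y (Suc n)) \<le> grid_norm \<omega> h1 h2 (y n)"
      by (simp add: w_def grid_norm_scale)
    then show ?thesis
      by (simp add: exp_minus field_simps)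
  qed
  then show ?thesis
    unfolding unconditionally_rho_stable_def rho_stable_def by blast
qed

end
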